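(* Let $X$ be a real linear space, $(Z,\mu',\min)$ an RN-space, and $\varphi:X^3\to Z$ a function such that there exists $0<\alpha<\frac12$ with $$\mu'_{\varphi(\frac x2,\frac y2,\frac z2)}(t)\ge\mu'_{\varphi(x,y,z)}\left(\frac t\alpha\right)\quad\text{for all }x,y,z\in X,\ t>0,$$ and $$\lim_{n\to\infty}\mu'_{\varphi(\frac x{2^n},\frac y{2^n},\frac z{2^n})}\left(\frac t{2^n}\right)=1\quad\text{for all }x,y,z\in X,\ t>0.$$ Let $(Y,\mu,\min)$ be a complete RN-space. If $f:X\to Y$ is a mapping such that $$\mu_{f\left(\frac{x+y+z}2\right)+f\left(\frac{x-y+z}2\right)-f(x)-f(z)}(t)\ge\mu'_{\varphi(x,y,z)}(t)\quad\text{for all }x,y,z\in X,\ t>0,$$ then the limit $A(x)=\lim_{n\to\infty}2^nf\left(\frac x{2^n}\right)$ exists for all $x\in X$ and defines a unique additive mapping $A:X\to Y$ such that $$\mu_{f(x)-A(x)}(t)\ge\mu'_{\varphi(x,2x,x)}\left(\frac{(1-2\alpha)t}{\alpha}\right)\quad\text{for all }x\in X,\ t>0.$$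
   Context: $D^+$ is the set of nondecreasing left-continuous functions $F:\mathbb{R}\to[0,1]$ with $F(0)=0$ and $\lim_{t\to+\infty}F(t)=1$; $H_0\in D^+$ is $H_0(t)=0$ for $t\le0$ and $H_0(t)=1$ for $t>0$. A random normed space (RN-space) is a triple $(X,\mu,T)$ with $X$ a real vector space, $T$ a continuous $t$-norm (e.g. $T=\min$ on $[0,1]^2$) and $\mu:X\to D^+$, $x\mapsto\mu_x$, such that: (a) $\mu_x(t)=H_0(t)$ for all $t>0$ iff $x=0$; (b) $\mu_{\alpha x}(t)=\mu_x(t/|\alpha|)$ for all real $\alpha\ne0$, $x\in X$, $t\ge0$; (c) $\mu_{x+y}(t+s)\ge T(\mu_x(t),\mu_y(s))$ for all $x,y\in X$, $t,s\ge0$. A sequence $x_n$ converges to $x$ if $\lim_{n\to\infty}\mu_{x_n-x}(t)=1$ for all $t>0$; it is Cauchy if $\lim_{n,m\to\infty}\mu_{x_n-x_m}(t)=1$ for all $t>0$; the RN-space is complete if every Cauchy sequence converges. Limits in $Y$ are in this sense. A mapping $A$ is additive if $A(x+y)=A(x)+A(y)$ for all $x,y$.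
   Formalization: The hypothesis f(0)=0 is added: without it the claim fails (φ=0 and f a nonzero constant satisfy every hypothesis, but 2^n f(0) diverges), and f(0)=0 is forced by the claimed existence of the limit at x=0. *)

theory Defs
  imports Complex_Main
begin

definition D_plus :: "(real \<Rightarrow> real) set" where
  "D_plus = {F. mono F \<and> range F \<subseteq> {0..1} \<and> (\<forall>t. continuous (at_left t) F) \<and>
                F 0 = 0 \<and> (F \<longlongrightarrow> 1) at_top}"

definition H0 :: "real \<Rightarrow> real" where
  "H0 t = (if t \<le> 0 then 0 else 1)"

(* T is only constrained on the unit square; its values elsewhere are irrelevant. *)
locale continuous_tnorm =
  fixes T :: "real \<Rightarrow> real \<Rightarrow> real"
  assumes closed: "a \<in> {0..1} \<Longrightarrow> b \<in> {0..1} \<Longrightarrow> T a b \<in> {0..1}"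
    and commute: "a \<in> {0..1} \<Longrightarrow> b \<in> {0..1} \<Longrightarrow> T a b = T b a"
    and assoc: "a \<in> {0..1} \<Longrightarrow> b \<in> {0..1} \<Longrightarrow> c \<in> {0..1} \<Longrightarrow> T (T a b) c = T a (T b c)"
    and unit: "a \<in> {0..1} \<Longrightarrow> T a 1 = a"
    and monotone: "a \<in> {0..1} \<Longrightarrow> b \<in> {0..1} \<Longrightarrow> c \<in> {0..1} \<Longrightarrow> d \<in> {0..1} \<Longrightarrow>
                     a \<le> c \<Longrightarrow> b \<le> d \<Longrightarrow> T a b \<le> T c d"
    and continuous: "continuous_on ({0..1} \<times> {0..1}) (\<lambda>(a, b). T a b)"

locale rn_space = continuous_tnorm T
  for \<mu> :: "'a::real_vector \<Rightarrow> real \<Rightarrow> real" and T :: "real \<Rightarrow> real \<Rightarrow> real" +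
  assumes dist_fun: "\<mu> x \<in> D_plus"
    and eq_H0_iff: "(\<forall>t>0. \<mu> x t = H0 t) \<longleftrightarrow> x = 0"
    and scale: "a \<noteq> 0 \<Longrightarrow> t \<ge> 0 \<Longrightarrow> \<mu> (a *\<^sub>R x) t = \<mu> x (t / \<bar>a\<bar>)"
    and triangle: "t \<ge> 0 \<Longrightarrow> s \<ge> 0 \<Longrightarrow> \<mu> (x + y) (t + s) \<ge> T (\<mu> x t) (\<mu> y s)"

definition rn_tendsto ::
    "('a::real_vector \<Rightarrow> real \<Rightarrow> real) \<Rightarrow> (nat \<Rightarrow> 'a) \<Rightarrow> 'a \<Rightarrow> bool" where
  "rn_tendsto \<mu> x l \<longleftrightarrow> (\<forall>t>0. (\<lambda>n. \<mu> (x n - l) t) \<longlonglongrightarrow> 1)"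

definition rn_Cauchy :: "('a::real_vector \<Rightarrow> real \<Rightarrow> real) \<Rightarrow> (nat \<Rightarrow> 'a) \<Rightarrow> bool" where
  "rn_Cauchy \<mu> x \<longleftrightarrow>
     (\<forall>t>0. ((\<lambda>(n, m). \<mu> (x n - x m) t) \<longlongrightarrow> 1) (sequentially \<times>\<^sub>F sequentially))"

locale complete_rn_space = rn_space \<mu> T
  for \<mu> :: "'a::real_vector \<Rightarrow> real \<Rightarrow> real" and T :: "real \<Rightarrow> real \<Rightarrow> real" +
  assumes complete: "rn_Cauchy \<mu> x \<Longrightarrow> \<exists>l. rn_tendsto \<mu> x l"

end

theory Submission
  imports Defs
begin

text \<open>
  Write \<open>f\<^sub>n x = 2^n f(x/2^n)\<close> and \<open>\<psi> x = \<mu>' (\<phi> x (2x) x)\<close>.  Substituting \<open>(x/2, x, x/2)\<close> in the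
  functional inequality turns the two midpoints into \<open>x\<close> and \<open>0\<close>.  Since \<open>f 0 = 0\<close>, this leaves
  \<open>\<mu> (f x - 2 f(x/2)) t \<ge> \<psi> (x/2) t \<ge> \<psi> x (t/\<alpha>)\<close>.  One step of the iteration therefore costs the share
  \<open>(1 - 2\<alpha>) t\<close> of the budget \<open>t\<close>, and the remaining \<open>2\<alpha>t\<close> is exactly what the same estimate at
  \<open>x/2\<close>, doubled, consumes.  Since the \<open>t\<close>-norm is the minimum, combining the two loses nothing, so
  \<open>\<mu> (f x - f\<^sub>n x) t \<ge> \<psi> x ((1 - 2\<alpha>) t/\<alpha>)\<close> for every \<open>n\<close>, with a constant independent of \<open>n\<close>
  (\<open>halving_iterates_bound\<close>).

  Rescaling this bound from \<open>x/2^n\<close> to \<open>x\<close> turns the right-hand side into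
  \<open>\<psi> (x/2^n) (const t/2^n)\<close>, which tends to \<open>1\<close> by hypothesis.  Thus \<open>f\<^sub>n x\<close> is Cauchy, and completeness
  gives a limit \<open>A x\<close>, which inherits the bound by left-continuity of distribution functions
  (\<open>lower_bound_limit\<close>).  The functional inequality at \<open>(x, x + z, z)\<close>, rescaled
  in the same way, shows that \<open>f\<^sub>n\<close> is additive in the limit.  Finally, an additive \<open>B\<close> that is as close
  to \<open>f\<close> as \<open>A\<close> satisfies \<open>B x = 2^n B(x/2^n)\<close>, so the same rescaling makes \<open>f\<^sub>n x\<close> converge
  to \<open>B x\<close> too (\<open>additive_is_halving_limit\<close>), and limits are unique.
\<close>

section \<open>Random normed spaces under the minimum\<close>

locale min_rn_space = rn_space \<mu> min
  for \<mu> :: "'a::real_vector \<Rightarrow> real \<Rightarrow> real"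
begin

lemma dist_le_1: "\<mu> x t \<le> 1"
  using dist_fun[of x] by (auto simp: D_plus_def image_subset_iff)

lemma dist_left_cont: "(\<mu> x \<longlongrightarrow> \<mu> x t) (at_left t)"
  using dist_fun[of x] by (auto simp: D_plus_def continuous_within)

lemma dist_zero: "t > 0 \<Longrightarrow> \<mu> 0 t = 1"
  using eq_H0_iff[of 0] by (simp add: H0_def)

lemma eq_zeroI: "(\<And>t. t > 0 \<Longrightarrow> \<mu> x t = 1) \<Longrightarrow> x = 0"
  using eq_H0_iff[of x] by (simp add: H0_def)

lemma dist_minus: "t > 0 \<Longrightarrow> \<mu> (- x) t = \<mu> x t"
  using scale[of "-1" t x] by simp

lemma dist_commute: "t > 0 \<Longrightarrow> \<mu> (x - y) t = \<mu> (y - x) t"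
  using dist_minus[of t "y - x"] by simp

lemma dist_scale: "a > 0 \<Longrightarrow> t > 0 \<Longrightarrow> \<mu> (a *\<^sub>R x) t = \<mu> x (t / a)"
  using scale[of a t x] by simp

lemma tendsto_1I:
  assumes "u \<longlonglongrightarrow> 1" "\<And>n. u n \<le> \<mu> (x n) t"
  shows "(\<lambda>n. \<mu> (x n) t) \<longlonglongrightarrow> 1"
  by (rule tendsto_sandwich[OF _ _ assms(1) tendsto_const]) (auto simp: assms(2) dist_le_1)

lemma rn_tendsto_unique:
  assumes "rn_tendsto \<mu> x l" "rn_tendsto \<mu> x m"
  shows "l = m"
proof -
  have "\<mu> (l - m) t = 1" if t: "t > 0" for t
  proof -
    have le: "min (\<mu> (x n - l) (t/2)) (\<mu> (x n - m) (t/2)) \<le> \<mu> (l - m) t" for n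
      using triangle[of "t/2" "t/2" "l - x n" "x n - m"] dist_commute[of "t/2" l "x n"] t
      by simp
    have "(\<lambda>n. min (\<mu> (x n - l) (t/2)) (\<mu> (x n - m) (t/2))) \<longlonglongrightarrow> min 1 1"
      using assms t unfolding rn_tendsto_def by (intro tendsto_min) auto
    then have "1 \<le> \<mu> (l - m) t"
      using LIMSEQ_le_const2 le by fastforce
    then show ?thesis
      using dist_le_1 by (simp add: antisym)
  qed
  then have "l - m = 0" by (rule eq_zeroI)
  then show ?thesis by simp
qed

lemma rn_tendsto_add:
  assumes "rn_tendsto \<mu> x l" "rn_tendsto \<mu> y m"
  shows "rn_tendsto \<mu> (\<lambda>n. x n + y n) (l + m)"
  unfolding rn_tendsto_def
proof (intro allI impI)
  fix t :: real assume t: "t > 0"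
  have lim: "(\<lambda>n. min (\<mu> (x n - l) (t/2)) (\<mu> (y n - m) (t/2))) \<longlonglongrightarrow> 1"
    using tendsto_min[of "\<lambda>n. \<mu> (x n - l) (t/2)" 1 sequentially "\<lambda>n. \<mu> (y n - m) (t/2)" 1] assms t
    unfolding rn_tendsto_def by simp
  show "(\<lambda>n. \<mu> (x n + y n - (l + m)) t) \<longlonglongrightarrow> 1"
  proof (rule tendsto_1I[OF lim])
    fix n
    show "min (\<mu> (x n - l) (t/2)) (\<mu> (y n - m) (t/2)) \<le> \<mu> (x n + y n - (l + m)) t"
      using triangle[of "t/2" "t/2" "x n - l" "y n - m"] t by (simp add: algebra_simps)
  qed
qed

lemma rn_CauchyI:
  assumes lim: "\<And>t. t > 0 \<Longrightarrow> u t \<longlonglongrightarrow> 1"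
    and le: "\<And>t m n. t > 0 \<Longrightarrow> m \<le> n \<Longrightarrow> u t m \<le> \<mu> (x m - x n) t"
  shows "rn_Cauchy \<mu> x"
  unfolding rn_Cauchy_def
proof (intro allI impI)
  fix t :: real assume t: "t > 0"
  have min_le: "u t (min m n) \<le> \<mu> (x m - x n) t" for m n
    using le[OF t, of m n] le[OF t, of n m] dist_commute[OF t, of "x m" "x n"]
    by (cases "m \<le> n") (auto simp: min_def)
  show "((\<lambda>(n, m). \<mu> (x n - x m) t) \<longlongrightarrow> 1) (sequentially \<times>\<^sub>F sequentially)"
  proof (rule order_tendstoI)
    fix a :: real assume "a < 1"
    then have "eventually (\<lambda>n. a < u t n) sequentially"
      using lim[OF t] by (simp add: order_tendsto_iff)
    then obtain N where N: "\<And>n. n \<ge> N \<Longrightarrow> a < u t n"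
      by (auto simp: eventually_sequentially)
    have "a < \<mu> (x m - x n) t" if "m \<ge> N" "n \<ge> N" for m n
      using N[of "min m n"] min_le[of m n] that by simp
    then show "eventually (\<lambda>p. a < (case p of (n, m) \<Rightarrow> \<mu> (x n - x m) t))
        (sequentially \<times>\<^sub>F sequentially)"
      by (auto simp: eventually_prod_sequentially)
  next
    fix a :: real assume "1 < a"
    then show "eventually (\<lambda>p. (case p of (n, m) \<Rightarrow> \<mu> (x n - x m) t) < a)
        (sequentially \<times>\<^sub>F sequentially)"
      using dist_le_1 by (intro always_eventually) (auto intro: le_less_trans)
  qed
qed

text \<open>
  Distribution functions need not be continuous from the right, so \<open>\<mu> (y - x n) t\<close> need not converge to
  \<open>\<mu> (y - l) t\<close>.  The bound still survives, because a slightly smaller \<open>s < t\<close> leaves the positive amount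
  \<open>t - s\<close> to absorb the error \<open>x n - l\<close>, and \<open>F\<close> recovers its value at \<open>t\<close> as \<open>s\<close> increases to \<open>t\<close>.
\<close>

lemma lower_bound_limit:
  assumes lim: "rn_tendsto \<mu> x l"
    and le: "\<And>n s. s > 0 \<Longrightarrow> F s \<le> \<mu> (y - x n) s"
    and cont: "(F \<longlongrightarrow> F t) (at_left t)" and t: "t > 0"
  shows "F t \<le> \<mu> (y - l) t"
proof -
  have below: "F s \<le> \<mu> (y - l) t" if s: "0 < s" "s < t" for s
  proof -
    have min_le: "min (F s) (\<mu> (x n - l) (t - s)) \<le> \<mu> (y - l) t" for n
      using triangle[of s "t - s" "y - x n" "x n - l"] le[of s n] s by simp
    have "(\<lambda>n. min (F s) (\<mu> (x n - l) (t - s))) \<longlonglongrightarrow> min (F s) 1"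
      using lim s unfolding rn_tendsto_def by (intro tendsto_min tendsto_const) auto
    then have "min (F s) 1 \<le> \<mu> (y - l) t"
      using LIMSEQ_le_const2 min_le by blast
    moreover have "F s \<le> 1"
      using le[of s 0] dist_le_1 s by (meson order_trans)
    ultimately show ?thesis by simp
  qed
  have "eventually (\<lambda>s. F s \<le> \<mu> (y - l) t) (at_left t)"
    using eventually_at_left_real[OF t] by eventually_elim (simp add: below)
  then show ?thesis
    by (intro tendsto_upperbound[OF cont]) auto
qed

section \<open>Iterated halving\<close>

text \<open>
  Replacing \<open>n\<close> by \<open>n + 1\<close> splits \<open>f x - 2^(n+1) f(x/2^(n+1))\<close> into the one-step error at \<open>x\<close> and twice
  the \<open>n\<close>-step error at \<open>x/2\<close>.  The budget \<open>t = (1 - 2\<alpha>) t + 2\<alpha>t\<close> is split so that both parts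
  meet the same value \<open>\<psi> x ((1 - 2\<alpha>) t/\<alpha>)\<close>; this replaces summing the geometric series of one-step
  errors.
\<close>

lemma halving_iterates_bound:
  fixes f :: "'x::real_vector \<Rightarrow> 'a" and \<psi> :: "'x \<Rightarrow> real \<Rightarrow> real"
  assumes \<alpha>: "0 < \<alpha>" "\<alpha> < 1/2"
    and \<psi>_le_1: "\<And>x t. \<psi> x t \<le> 1"
    and \<psi>_half: "\<And>x t. t > 0 \<Longrightarrow> \<psi> x (t / \<alpha>) \<le> \<psi> ((1/2) *\<^sub>R x) t"
    and step: "\<And>x t. t > 0 \<Longrightarrow> \<psi> x (t / \<alpha>) \<le> \<mu> (f x - 2 *\<^sub>R f ((1/2) *\<^sub>R x)) t"
    and t: "t > 0"
  shows "\<psi> x ((1 - 2*\<alpha>) * t / \<alpha>) \<le> \<mu> (f x - 2^n *\<^sub>R f ((1/2^n) *\<^sub>R x)) t"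
  using t
proof (induction n arbitrary: x t)
  case 0
  then show ?case by (simp add: dist_zero \<psi>_le_1)
next
  case (Suc n)
  let ?h = "(1/2) *\<^sub>R x"
  let ?e1 = "f x - 2 *\<^sub>R f ?h"
  let ?e2 = "f ?h - 2^n *\<^sub>R f ((1/2^n) *\<^sub>R ?h)"
  have pos: "(1 - 2*\<alpha>) * t > 0" "\<alpha> * t > 0" "2 * (\<alpha> * t) > 0"
    using \<alpha> Suc.prems by auto
  have first: "\<psi> x ((1 - 2*\<alpha>) * t / \<alpha>) \<le> \<mu> ?e1 ((1 - 2*\<alpha>) * t)"
    using step[OF pos(1)] .
  have "\<psi> x ((1 - 2*\<alpha>) * t / \<alpha>) \<le> \<psi> ?h ((1 - 2*\<alpha>) * (\<alpha> * t) / \<alpha>)"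
    using \<psi>_half[OF pos(1), of x] \<alpha> by simp
  also have "\<dots> \<le> \<mu> ?e2 (\<alpha> * t)"
    using Suc.IH[OF pos(2)] .
  also have "\<dots> = \<mu> (2 *\<^sub>R ?e2) (2 * (\<alpha> * t))"
    using dist_scale[of 2 "2 * (\<alpha> * t)" ?e2] pos(3) by simp
  finally have second: "\<psi> x ((1 - 2*\<alpha>) * t / \<alpha>) \<le> \<mu> (2 *\<^sub>R ?e2) (2 * (\<alpha> * t))" .
  have combined: "min (\<mu> ?e1 ((1 - 2*\<alpha>) * t)) (\<mu> (2 *\<^sub>R ?e2) (2 * (\<alpha> * t)))
      \<le> \<mu> (?e1 + 2 *\<^sub>R ?e2) ((1 - 2*\<alpha>) * t + 2 * (\<alpha> * t))"
    using pos by (intro triangle) auto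
  have budget: "(1 - 2*\<alpha>) * t + 2 * (\<alpha> * t) = t"
    by (simp add: algebra_simps)
  have total: "?e1 + 2 *\<^sub>R ?e2 = f x - 2^Suc n *\<^sub>R f ((1/2^Suc n) *\<^sub>R x)"
    by (simp add: scaleR_diff_right mult.commute)
  show ?case
    using order_trans[OF min.boundedI[OF first second] combined] unfolding budget total .
qed

text \<open>
  Homogeneity of \<open>\<mu>\<close> moves the factor \<open>2^n\<close> into the time argument, which brings every later estimate
  into the form \<open>\<psi> (x/2^n) (const/2^n)\<close> whose limit is known to be \<open>1\<close>.
\<close>

lemma rescaled_bound:
  fixes g h :: "'x::real_vector \<Rightarrow> 'a"
  assumes le: "\<And>x t. t > 0 \<Longrightarrow> \<psi> x (c * t) \<le> \<mu> (g x - h x) t" and t: "t > 0"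
  shows "\<psi> ((1/2^n) *\<^sub>R x) (c * t / 2^n)
    \<le> \<mu> (2^n *\<^sub>R g ((1/2^n) *\<^sub>R x) - 2^n *\<^sub>R h ((1/2^n) *\<^sub>R x)) t"
  using le[of "t / 2^n" "(1/2^n) *\<^sub>R x"]
    dist_scale[of "2^n" t "g ((1/2^n) *\<^sub>R x) - h ((1/2^n) *\<^sub>R x)"] t
  by (simp add: scaleR_diff_right)

text \<open>
  An additive map commutes with multiplication by \<open>2^n\<close>, so the iterates of \<open>B\<close> are constant and the
  rescaled distance from \<open>f\<close> to \<open>B\<close> is the distance from the iterates of \<open>f\<close> to the single point \<open>B x\<close>.
  Any such \<open>B\<close> is therefore determined by \<open>f\<close>.
\<close>

lemma additive_is_halving_limit:
  fixes f B :: "'x::real_vector \<Rightarrow> 'a"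
  assumes B: "Modules.additive B"
    and le: "\<And>x t. t > 0 \<Longrightarrow> \<psi> x (c * t) \<le> \<mu> (f x - B x) t"
    and lim: "\<And>x t. t > 0 \<Longrightarrow> (\<lambda>n. \<psi> ((1/2^n) *\<^sub>R x) (t / 2^n)) \<longlonglongrightarrow> 1"
    and c: "c > 0"
  shows "rn_tendsto \<mu> (\<lambda>n. 2^n *\<^sub>R f ((1/2^n) *\<^sub>R x)) (B x)"
  unfolding rn_tendsto_def
proof (intro allI impI)
  fix t :: real assume t: "t > 0"
  have double: "B (2 *\<^sub>R y) = 2 *\<^sub>R B y" for y
    using additive.add[OF B, of y y] by (simp add: scaleR_2)
  have power: "B (2^n *\<^sub>R y) = 2^n *\<^sub>R B y" for n y
  proof (induction n)
    case (Suc n)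
    then show ?case using double[of "2^n *\<^sub>R y"] by simp
  qed simp
  have B_eq: "2^n *\<^sub>R B ((1/2^n) *\<^sub>R x) = B x" for n
    using power[of n "(1/2^n) *\<^sub>R x"] by simp
  have "c * t > 0" using c t by simp
  show "(\<lambda>n. \<mu> (2^n *\<^sub>R f ((1/2^n) *\<^sub>R x) - B x) t) \<longlonglongrightarrow> 1"
  proof (rule tendsto_1I[OF lim[OF \<open>c * t > 0\<close>]])
    fix n
    show "\<psi> ((1/2^n) *\<^sub>R x) (c * t / 2^n) \<le> \<mu> (2^n *\<^sub>R f ((1/2^n) *\<^sub>R x) - B x) t"
      using rescaled_bound[of \<psi> c f B, OF le t, of n x] unfolding B_eq .
  qed
qed

text \<open>
  The difference of the \<open>m\<close>-th and \<open>(m + k)\<close>-th iterates at \<open>x\<close> is \<open>2^m\<close> times the distance from \<open>f\<close> to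
  its \<open>k\<close>-th iterate at \<open>x/2^m\<close>.  The bound on the latter does not depend on \<open>k\<close>.
\<close>

lemma halving_iterates_Cauchy:
  fixes f :: "'x::real_vector \<Rightarrow> 'a"
  assumes le: "\<And>x t n. t > 0 \<Longrightarrow> \<psi> x (c * t) \<le> \<mu> (f x - 2^n *\<^sub>R f ((1/2^n) *\<^sub>R x)) t"
    and lim: "\<And>x t. t > 0 \<Longrightarrow> (\<lambda>n. \<psi> ((1/2^n) *\<^sub>R x) (t / 2^n)) \<longlonglongrightarrow> 1"
    and c: "c > 0"
  shows "rn_Cauchy \<mu> (\<lambda>n. 2^n *\<^sub>R f ((1/2^n) *\<^sub>R x))"
proof (rule rn_CauchyI[where u = "\<lambda>t n. \<psi> ((1/2^n) *\<^sub>R x) (c * t / 2^n)"])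
  fix t :: real assume "t > 0"
  then show "(\<lambda>n. \<psi> ((1/2^n) *\<^sub>R x) (c * t / 2^n)) \<longlonglongrightarrow> 1"
    using lim c by simp
next
  fix t :: real and m n :: nat assume t: "t > 0" and "m \<le> n"
  then obtain k where n: "n = m + k" using le_Suc_ex by blast
  show "\<psi> ((1/2^m) *\<^sub>R x) (c * t / 2^m)
      \<le> \<mu> (2^m *\<^sub>R f ((1/2^m) *\<^sub>R x) - 2^n *\<^sub>R f ((1/2^n) *\<^sub>R x)) t"
    using rescaled_bound[of \<psi> c f "\<lambda>x. 2^k *\<^sub>R f ((1/2^k) *\<^sub>R x)", OF le t, of m x]
    by (simp add: n power_add mult.commute)
qed

text \<open>
  The identity \<open>f\<^sub>n (x + y) = (f\<^sub>n x + f\<^sub>n y) + d n\<close> with defect \<open>d n\<close> tending to \<open>0\<close> computes the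
  limit at \<open>x + y\<close> in two ways.
\<close>

lemma halving_limit_additive:
  fixes f :: "'x::real_vector \<Rightarrow> 'a"
  assumes A: "\<And>x. rn_tendsto \<mu> (\<lambda>n. 2^n *\<^sub>R f ((1/2^n) *\<^sub>R x)) (A x)"
    and defect: "\<And>x y t. t > 0 \<Longrightarrow> (\<lambda>n. \<mu> (f ((1/2^n) *\<^sub>R (x + y))
          - f ((1/2^n) *\<^sub>R x) - f ((1/2^n) *\<^sub>R y)) (t / 2^n)) \<longlonglongrightarrow> 1"
  shows "Modules.additive A"
proof
  fix x y :: 'x
  let ?f = "\<lambda>n x. 2^n *\<^sub>R f ((1/2^n) *\<^sub>R x)"
  let ?d = "\<lambda>n. f ((1/2^n) *\<^sub>R (x + y)) - f ((1/2^n) *\<^sub>R x) - f ((1/2^n) *\<^sub>R y)"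
  have "rn_tendsto \<mu> (\<lambda>n. 2^n *\<^sub>R ?d n) 0"
    using defect[of _ x y] by (simp add: rn_tendsto_def dist_scale)
  then have "rn_tendsto \<mu> (\<lambda>n. ?f n x + ?f n y + 2^n *\<^sub>R ?d n) (A x + A y + 0)"
    by (intro rn_tendsto_add A)
  moreover have "?f n x + ?f n y + 2^n *\<^sub>R ?d n = ?f n (x + y)" for n
    by (simp add: scaleR_diff_right del: scaleR_scaleR)
  ultimately have "rn_tendsto \<mu> (\<lambda>n. ?f n (x + y)) (A x + A y)"
    by simp
  then show "A (x + y) = A x + A y"
    using rn_tendsto_unique A by blast
qed

end

section \<open>Stability of the functional equation\<close>

(* The hypothesis f 0 = 0 is left implicit in the source but cannot be dropped: a nonzero
   constant f satisfies all other hypotheses with \<phi> = 0, while 2^n *\<^sub>R f 0 diverges. *)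
theorem theorem3p1:
  fixes \<mu>' :: "'z::real_vector \<Rightarrow> real \<Rightarrow> real"
    and \<mu> :: "'y::real_vector \<Rightarrow> real \<Rightarrow> real"
    and \<phi> :: "'x::real_vector \<Rightarrow> 'x \<Rightarrow> 'x \<Rightarrow> 'z"
    and f :: "'x \<Rightarrow> 'y"
    and \<alpha> :: real
  assumes Z: "rn_space \<mu>' min"
    and \<alpha>: "0 < \<alpha>" "\<alpha> < 1/2"
    and \<phi>_half: "\<And>x y z t. t > 0 \<Longrightarrow>
          \<mu>' (\<phi> ((1/2) *\<^sub>R x) ((1/2) *\<^sub>R y) ((1/2) *\<^sub>R z)) t \<ge> \<mu>' (\<phi> x y z) (t / \<alpha>)"
    and \<phi>_lim: "\<And>x y z t. t > 0 \<Longrightarrow>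
          (\<lambda>n. \<mu>' (\<phi> ((1/2^n) *\<^sub>R x) ((1/2^n) *\<^sub>R y) ((1/2^n) *\<^sub>R z)) (t / 2^n)) \<longlonglongrightarrow> 1"
    and Y: "complete_rn_space \<mu> min"
    and f_0: "f 0 = 0"
    and f_ineq: "\<And>x y z t. t > 0 \<Longrightarrow>
          \<mu> (f ((1/2) *\<^sub>R (x + y + z)) + f ((1/2) *\<^sub>R (x - y + z)) - f x - f z) t
            \<ge> \<mu>' (\<phi> x y z) t"
  shows "\<exists>A :: 'x \<Rightarrow> 'y.
           (\<forall>x. rn_tendsto \<mu> (\<lambda>n. 2^n *\<^sub>R f ((1/2^n) *\<^sub>R x)) (A x)) \<and>
           Modules.additive A \<and>
           (\<forall>x t. t > 0 \<longrightarrow> \<mu> (f x - A x) t \<ge> \<mu>' (\<phi> x (2 *\<^sub>R x) x) ((1 - 2*\<alpha>) * t / \<alpha>)) \<and>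
           (\<forall>B. Modules.additive B \<longrightarrow>
             (\<forall>x t. t > 0 \<longrightarrow> \<mu> (f x - B x) t \<ge> \<mu>' (\<phi> x (2 *\<^sub>R x) x) ((1 - 2*\<alpha>) * t / \<alpha>)) \<longrightarrow>
             B = A)"
proof -
  interpret Z: min_rn_space \<mu>' using Z by (rule min_rn_space.intro)
  interpret Y: complete_rn_space \<mu> min by (rule Y)
  interpret Y: min_rn_space \<mu> by unfold_locales
  define \<psi> where "\<psi> x = \<mu>' (\<phi> x (2 *\<^sub>R x) x)" for x
  define c where "c = (1 - 2*\<alpha>) / \<alpha>"
  have c: "c > 0" using \<alpha> by (simp add: c_def)
  have c_mult: "(1 - 2*\<alpha>) * t / \<alpha> = c * t" for t by (simp add: c_def)
  let ?f = "\<lambda>x n. 2^n *\<^sub>R f ((1/2^n) *\<^sub>R x)"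
  have \<psi>_half: "\<psi> x (t / \<alpha>) \<le> \<psi> ((1/2) *\<^sub>R x) t" if "t > 0" for x t
    using \<phi>_half[OF that, of x "2 *\<^sub>R x" x] by (simp add: \<psi>_def)
  have \<psi>_lim: "(\<lambda>n. \<psi> ((1/2^n) *\<^sub>R x) (t / 2^n)) \<longlonglongrightarrow> 1" if "t > 0" for x t
    using \<phi>_lim[OF that, of x "2 *\<^sub>R x" x] by (simp add: \<psi>_def mult.commute)
  \<comment> \<open>The choice \<open>y = x + z\<close> makes the two midpoints \<open>x + z\<close> and \<open>0\<close>.\<close>
  have additive_defect: "\<mu>' (\<phi> x (x + z) z) t \<le> \<mu> (f (x + z) - f x - f z) t" if "t > 0" for x z t
  proof -
    have "(1/2) *\<^sub>R (x + (x + z) + z) = x + z"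
      by (metis (no_types) add.assoc add.commute scaleR_half_double)
    then show ?thesis
      using f_ineq[OF that, of x "x + z" z] by (simp add: f_0)
  qed
  have step: "\<psi> x (t / \<alpha>) \<le> \<mu> (f x - 2 *\<^sub>R f ((1/2) *\<^sub>R x)) t" if "t > 0" for x t
  proof -
    let ?h = "(1/2) *\<^sub>R x"
    have h: "?h + ?h = x" by (simp flip: scaleR_add_left)
    have "\<psi> ?h t \<le> \<mu> (f x - 2 *\<^sub>R f ?h) t"
      using additive_defect[OF that, of ?h ?h] unfolding h
      by (simp add: \<psi>_def scaleR_2 diff_diff_eq)
    then show ?thesis using \<psi>_half[OF that, of x] by simp
  qed
  have bound: "\<psi> x (c * t) \<le> \<mu> (f x - ?f x n) t" if "t > 0" for x t n
    using Y.halving_iterates_bound[of \<alpha> \<psi> f, OF \<alpha> _ \<psi>_half step that] Z.dist_le_1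
    by (simp add: \<psi>_def c_mult)
  have "\<exists>l. rn_tendsto \<mu> (?f x) l" for x
    using Y.complete Y.halving_iterates_Cauchy[of \<psi> c f, OF bound \<psi>_lim c] by blast
  then obtain A where A: "\<And>x. rn_tendsto \<mu> (?f x) (A x)" by metis
  have "Modules.additive A"
  proof (rule Y.halving_limit_additive[OF A])
    fix x z :: 'x and t :: real assume t: "t > 0"
    show "(\<lambda>n. \<mu> (f ((1/2^n) *\<^sub>R (x + z)) - f ((1/2^n) *\<^sub>R x) - f ((1/2^n) *\<^sub>R z)) (t / 2^n))
        \<longlonglongrightarrow> 1"
    proof (rule tendsto_sandwich[OF _ _ \<phi>_lim[OF t, of x "x + z" z] tendsto_const])
      show "eventually (\<lambda>n. \<mu>' (\<phi> ((1/2^n) *\<^sub>R x) ((1/2^n) *\<^sub>R (x + z)) ((1/2^n) *\<^sub>R z)) (t / 2^n)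
          \<le> \<mu> (f ((1/2^n) *\<^sub>R (x + z)) - f ((1/2^n) *\<^sub>R x) - f ((1/2^n) *\<^sub>R z)) (t / 2^n)) sequentially"
        using additive_defect[of "t / 2^n" "(1/2^n) *\<^sub>R x" "(1/2^n) *\<^sub>R z" for n] t
        by (intro always_eventually) (simp add: scaleR_add_right)
    qed (simp add: Y.dist_le_1)
  qed
  moreover have "\<psi> x (c * t) \<le> \<mu> (f x - A x) t" if t: "t > 0" for x t
  proof (rule Y.lower_bound_limit[where F = "\<lambda>s. \<psi> x (c * s)", OF A bound _ t])
    \<comment> \<open>Multiplication by \<open>c > 0\<close> approaches \<open>c * t\<close> from the left only.\<close>
    have "filterlim (\<lambda>s. c * s) (at_left (c * t)) (at_left t)"
      using c by (auto simp: filterlim_at eventually_at_filter intro!: tendsto_eq_intros)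
    then show "((\<lambda>s. \<psi> x (c * s)) \<longlongrightarrow> \<psi> x (c * t)) (at_left t)"
      unfolding \<psi>_def by (rule filterlim_compose[OF Z.dist_left_cont])
  qed
  moreover have "B = A"
    if "Modules.additive B" "\<And>x t. t > 0 \<Longrightarrow> \<psi> x (c * t) \<le> \<mu> (f x - B x) t" for B
    using Y.additive_is_halving_limit[OF that \<psi>_lim c] Y.rn_tendsto_unique A by blast
  ultimately show ?thesis
    using A unfolding c_mult \<psi>_def[symmetric] by blast
qed

end
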